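(* For every positive integer $n$, $$t(1,1,1,7;n)=4N(1,1,1,7;4n+5)-2N(1,1,1,7;8n+10)$$ and $$t(1,7,7,7;n)=4N(1,7,7,7;4n+11)-2N(1,7,7,7;8n+22).$$
   Context: For positive integers $a_1,\dots,a_k$ and a nonnegative integer $n$, $N(a_1,\dots,a_k;n)$ is the number of $(x_1,\dots,x_k)\in\mathbb Z^k$ with $n=a_1x_1^2+\cdots+a_kx_k^2$, and $t(a_1,\dots,a_k;n)$ is the number of $(x_1,\dots,x_k)\in\mathbb Z^k$ with $n=a_1\frac{x_1(x_1-1)}2+\cdots+a_k\frac{x_k(x_k-1)}2$. *)

theory Defs
  imports Main
begin

text \<open>
  \<open>N_rep [a\<^sub>1, \<dots>, a\<^sub>k] n\<close> is $N(a_1,\dots,a_k;n)$ and \<open>t_rep [a\<^sub>1, \<dots>, a\<^sub>k] n\<close> is $t(a_1,\dots,a_k;n)$.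
  The coefficients $a_1,\dots,a_k$ form a list, and $(x_1,\dots,x_k)$ is an integer list of the
  same length. If all coefficients are positive, the solution sets are finite (lemmas
  \<open>finite_rep_squares\<close> and \<open>finite_rep_triangular\<close>), so \<^const>\<open>card\<close> is the true count.
\<close>

definition rep_squares :: "nat list \<Rightarrow> nat \<Rightarrow> int list set" where
  "rep_squares a n =
     {x. length x = length a \<and> int n = (\<Sum>i<length a. int (a ! i) * (x ! i)\<^sup>2)}"

text \<open>The division by 2 is exact, as \<open>x * (x - 1)\<close> is even.\<close>

definition rep_triangular :: "nat list \<Rightarrow> nat \<Rightarrow> int list set" where
  "rep_triangular a n =
     {x. length x = length a \<and>
         int n = (\<Sum>i<length a. int (a ! i) * (x ! i * (x ! i - 1) div 2))}"

definition N_rep :: "nat list \<Rightarrow> nat \<Rightarrow> nat" where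
  "N_rep a n = card (rep_squares a n)"

definition t_rep :: "nat list \<Rightarrow> nat \<Rightarrow> nat" where
  "t_rep a n = card (rep_triangular a n)"

lemma finite_rep_aux:
  fixes f :: "int \<Rightarrow> int"
  assumes pos: "\<forall>c\<in>set a. 0 < c"
    and nonneg: "\<And>y. 0 \<le> f y"
    and bound: "\<And>y. \<bar>y\<bar> \<le> f y + 1"
  shows "finite {x. length x = length a \<and> int n = (\<Sum>i<length a. int (a ! i) * f (x ! i))}"
proof (rule finite_subset)
  show "{x. length x = length a \<and> int n = (\<Sum>i<length a. int (a ! i) * f (x ! i))}
          \<subseteq> {x. set x \<subseteq> {- int n - 1..int n + 1} \<and> length x = length a}"
  proof (intro subsetI CollectI conjI)
    fix x y
    assume "x \<in> {x. length x = length a \<and> int n = (\<Sum>i<length a. int (a ! i) * f (x ! i))}"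
    then have len: "length x = length a"
      and eq: "int n = (\<Sum>i<length a. int (a ! i) * f (x ! i))"
      by auto
    show "length x = length a" by (fact len)
    assume "y \<in> set x"
    with len obtain j where j: "j < length a" "y = x ! j"
      by (metis in_set_conv_nth)
    have "1 * f y \<le> int (a ! j) * f (x ! j)"
      unfolding j(2) using pos j(1) nonneg by (intro mult_right_mono) (auto simp: Suc_le_eq)
    also have "\<dots> \<le> (\<Sum>i<length a. int (a ! i) * f (x ! i))"
      using j(1) nonneg by (intro member_le_sum) auto
    finally have "\<bar>y\<bar> \<le> int n + 1"
      using bound[of y] eq by linarith
    then show "y \<in> {- int n - 1..int n + 1}"
      by auto
  qed
  show "finite {x :: int list. set x \<subseteq> {- int n - 1..int n + 1} \<and> length x = length a}"
    by (rule finite_lists_length_eq) simp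
qed

lemma finite_rep_squares:
  assumes "\<forall>c\<in>set a. 0 < c"
  shows "finite (rep_squares a n)"
  unfolding rep_squares_def
proof (rule finite_rep_aux[OF assms])
  fix y :: int
  show "0 \<le> y\<^sup>2" by simp
  have "0 \<le> (\<bar>y\<bar> - 1) * \<bar>y\<bar>"
    by (cases "y = 0") auto
  then show "\<bar>y\<bar> \<le> y\<^sup>2 + 1"
    by (simp add: power2_eq_square left_diff_distrib)
qed

lemma finite_rep_triangular:
  assumes "\<forall>c\<in>set a. 0 < c"
  shows "finite (rep_triangular a n)"
  unfolding rep_triangular_def
proof (rule finite_rep_aux[OF assms])
  fix y :: int
  have "2 * \<bar>y\<bar> \<le> y * (y - 1) + 2"
  proof (cases "y \<le> 0")
    case True
    have "0 \<le> y * (y + 1)"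
      using True by (cases "y = 0") (auto intro: mult_nonpos_nonpos)
    then show ?thesis using True by (simp add: algebra_simps)
  next
    case False
    have "0 \<le> (y - 1) * (y - 2)"
      using False by (cases "y = 1") auto
    then show ?thesis using False by (simp add: algebra_simps)
  qed
  then show "\<bar>y\<bar> \<le> y * (y - 1) div 2 + 1"
    by linarith
  show "0 \<le> y * (y - 1) div 2"
    by (cases "y \<le> 0") (auto simp: mult_nonpos_nonpos)
qed

end

theory Submission
  imports Defs
begin

text \<open>
  Completing squares, \<open>t(c,c,c,d; n)\<close> counts the solutions of
  \<open>c(x\<^sup>2 + y\<^sup>2 + z\<^sup>2) + dw\<^sup>2 = 2m\<close> in odd integers, where \<open>{c, d} = {1, 7}\<close> and
  \<open>m = 4n + (3c + d)/2 \<equiv> c (mod 4)\<close>. Congruences modulo 4 show that the solutions for \<open>2m\<close> are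
  these \<open>O\<close> odd ones and three classes, permuted by the symmetry in \<open>x, y, z\<close>, each of the size
  \<open>E\<close> of the class with \<open>x, y\<close> odd and \<open>z, w\<close> even. Similarly, in each solution for \<open>m\<close> exactly
  one of \<open>x, y, z\<close> differs in parity from \<open>w\<close>, so \<open>2 N(m) = 3 S\<close> where \<open>S\<close> counts those with
  \<open>z \<equiv> w (mod 2)\<close>.

  The prime 2 splits in \<open>\<rat>(\<surd>-7)\<close> as the product of \<open>\<pi> = (1 + \<surd>-7)/2\<close> and its conjugate.
  Multiplying the part \<open>cz\<^sup>2 + dw\<^sup>2\<close> by \<open>\<pi>\<close> or its conjugate, and \<open>x + iy\<close> by \<open>1 + i\<close>, gives two
  injections from the solutions counted by \<open>S\<close> to the solutions for \<open>2m\<close> with \<open>x, y\<close> odd. Their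
  images cover all of these and meet in the class counted by \<open>E\<close>. Hence \<open>O + 2E = 2S\<close>, and
  \<open>4 N(m) - 2 N(2m) = 6S - 2(O + 3E) = O\<close>.
\<close>

text \<open>The lone coefficient \<open>d\<close> always sits on the last coordinate
  \<open>w\<close>, so both forms of the theorem are treated at once, with \<open>(c, d)\<close>
  equal to \<open>(1, 7)\<close> or \<open>(7, 1)\<close>.\<close>

definition quad_sols :: "int \<Rightarrow> int \<Rightarrow> int \<Rightarrow> (int \<times> int \<times> int \<times> int) set" where
  "quad_sols c d k = {(x, y, z, w). c * (x\<^sup>2 + y\<^sup>2 + z\<^sup>2) + d * w\<^sup>2 = k}"

section \<open>Congruences modulo 4 and 8\<close>

lemma square_of_even:
  fixes x :: int
  assumes "even x"
  obtains k where "x\<^sup>2 = 4 * k" "even k \<longleftrightarrow> 4 dvd x"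
proof -
  from assms obtain y where y: "x = 2 * y" by blast
  have "x\<^sup>2 = 4 * y\<^sup>2" "even (y\<^sup>2) \<longleftrightarrow> 4 dvd x"
    by (simp_all add: y power2_eq_square) presburger
  then show thesis by (rule that)
qed

lemma square_of_odd:
  fixes x :: int
  assumes "odd x"
  obtains k where "x\<^sup>2 = 8 * k + 1"
proof -
  from assms obtain y where y: "x = 2 * y + 1" by (elim oddE)
  have "even (y * (y + 1))" by simp
  then obtain k where "y * (y + 1) = 2 * k" by blast
  then have "x\<^sup>2 = 8 * k + 1"
    by (simp add: y power2_eq_square algebra_simps)
  then show thesis by (rule that)
qed

text \<open>Modulo 4 every square equals the parity of its root, and \<open>d = 8 - c\<close> is
  congruent to \<open>- c\<close>.\<close>

lemma quad_sols_mod_4: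
  fixes c d k :: int
  assumes cd: "c = 1 \<and> d = 7 \<or> c = 7 \<and> d = 1"
    and sol: "(x, y, z, w) \<in> quad_sols c d k"
  shows "4 dvd c * (x mod 2 + y mod 2 + z mod 2 - w mod 2) - k"
proof -
  have split: "\<exists>k. v\<^sup>2 = 4 * k + v mod 2" for v :: int
  proof (cases "even v")
    case True
    then obtain k where "v\<^sup>2 = 4 * k" by (rule square_of_even)
    with True show ?thesis by (simp add: mod_0_imp_dvd)
  next
    case False
    then obtain k where "v\<^sup>2 = 8 * k + 1" by (rule square_of_odd)
    with False show ?thesis by (intro exI[of _ "2 * k"]) (simp add: odd_iff_mod_2_eq_one)
  qed
  obtain k1 where 1: "x\<^sup>2 = 4 * k1 + x mod 2" using split by blast
  obtain k2 where 2: "y\<^sup>2 = 4 * k2 + y mod 2" using split by blast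
  obtain k3 where 3: "z\<^sup>2 = 4 * k3 + z mod 2" using split by blast
  obtain k4 where 4: "w\<^sup>2 = 4 * k4 + w mod 2" using split by blast
  have d: "d = 8 - c" using cd by auto
  have "c * (x mod 2 + y mod 2 + z mod 2 - w mod 2) - k
      = 4 * (- c * (k1 + k2 + k3) - d * k4 - 2 * (w mod 2))"
    using sol unfolding quad_sols_def d by (simp add: 1 2 3 4 algebra_simps)
  then show ?thesis by (metis dvd_triv_left)
qed

text \<open>As \<open>c\<close> is odd, it cancels modulo 4, so the signed sum of parities is 2
  modulo 4. This sum lies between -1 and 3, hence equals 2.\<close>

lemma quad_sols_parity_twice:
  fixes c d m :: int
  assumes cd: "c = 1 \<and> d = 7 \<or> c = 7 \<and> d = 1" and m: "4 dvd m - c"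
    and sol: "(x, y, z, w) \<in> quad_sols c d (2 * m)"
  shows "odd x \<and> odd y \<and> odd z \<and> odd w
    \<or> even w \<and> (odd x \<and> odd y \<and> even z \<or> odd x \<and> even y \<and> odd z \<or> even x \<and> odd y \<and> odd z)"
proof -
  have "4 dvd s - 2" if "4 dvd c * s - 2 * m" for s
    using that cd m by (elim disjE conjE; hypsubst; presburger)
  from this[OF quad_sols_mod_4[OF cd sol]]
  have "4 dvd (x mod 2 + y mod 2 + z mod 2 - w mod 2) - 2" .
  then show ?thesis
    by (cases "even x"; cases "even y"; cases "even z"; cases "even w"; simp add: mod2_eq_if)
qed

text \<open>Here the signed sum of parities equals 1: one of \<open>x, y, z\<close> is odd if
  \<open>w\<close> is even, and two are odd if \<open>w\<close> is odd.\<close>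

lemma quad_sols_parity:
  fixes c d m :: int
  assumes cd: "c = 1 \<and> d = 7 \<or> c = 7 \<and> d = 1" and m: "4 dvd m - c"
    and sol: "(x, y, z, w) \<in> quad_sols c d m"
  shows "odd (x - w) \<and> even (y - w) \<and> even (z - w) \<or> even (x - w) \<and> odd (y - w) \<and> even (z - w)
    \<or> even (x - w) \<and> even (y - w) \<and> odd (z - w)"
proof -
  have "4 dvd s - 1" if "4 dvd c * s - m" for s
    using that cd m by (elim disjE conjE; hypsubst; presburger)
  from this[OF quad_sols_mod_4[OF cd sol]]
  have "4 dvd (x mod 2 + y mod 2 + z mod 2 - w mod 2) - 1" .
  then show ?thesis
    by (cases "even x"; cases "even y"; cases "even z"; cases "even w"; simp add: mod2_eq_if)
qed

text \<open>Modulo 8 the odd squares contribute \<open>2 * c\<close>, which is also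
  \<open>2 * m\<close>, so 8 divides \<open>c * z\<^sup>2 + d * w\<^sup>2\<close>. Hence
  \<open>z\<close> and \<open>w\<close> are both 0 or both 2 modulo 4. This places the class counted
  by \<open>E\<close> in both images.\<close>

lemma four_dvd_of_even_tail:
  fixes c d m :: int
  assumes cd: "c = 1 \<and> d = 7 \<or> c = 7 \<and> d = 1" and m: "4 dvd m - c"
    and sol: "(x, y, z, w) \<in> quad_sols c d (2 * m)"
    and par: "odd x" "odd y" "even z" "even w"
  shows "4 dvd z + d * w \<and> 4 dvd z - d * w"
proof -
  obtain k1 where 1: "x\<^sup>2 = 8 * k1 + 1" using par square_of_odd by blast
  obtain k2 where 2: "y\<^sup>2 = 8 * k2 + 1" using par square_of_odd by blast
  obtain k3 where 3: "z\<^sup>2 = 4 * k3" "even k3 \<longleftrightarrow> 4 dvd z" using par square_of_even by blast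
  obtain k4 where 4: "w\<^sup>2 = 4 * k4" "even k4 \<longleftrightarrow> 4 dvd w" using par square_of_even by blast
  obtain j where j: "m = 4 * j + c" using m by (metis dvdE diff_add_cancel)
  have "c * (x\<^sup>2 + y\<^sup>2 + z\<^sup>2) + d * w\<^sup>2 = 8 * j + 2 * c"
    using sol j by (simp add: quad_sols_def)
  with cd 1 2 3(1) 4(1)
  \<comment> \<open>The equation divided by 4, with one disjunct for each choice of
    \<open>(c, d)\<close>.\<close>
  have "k3 + k4 = 2 * (j - k1 - k2 - 3 * k4) \<or> k3 + k4 = 2 * (j - 7 * k1 - 7 * k2 - 3 * k3)"
    by auto
  then have "even (k3 + k4)"
    by (elim disjE; metis dvd_triv_left)
  with 3(2) 4(2) par have "4 dvd z + w" "4 dvd z - w"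
    by presburger+
  with cd show ?thesis
    by (elim disjE conjE; hypsubst; presburger)
qed

section \<open>Finiteness and a criterion for bijections\<close>

lemma finite_quad_sols:
  assumes "c > 0" "d > 0"
  shows "finite (quad_sols c d k)"
proof (rule finite_subset)
  let ?I = "{- \<bar>k\<bar>..\<bar>k\<bar>}"
  have le: "\<bar>v\<bar> \<le> v\<^sup>2" for v :: int
  proof -
    have "0 \<le> (\<bar>v\<bar> - 1) * \<bar>v\<bar>"
      by (cases "v = 0") auto
    then show ?thesis
      by (simp add: power2_eq_square left_diff_distrib)
  qed
  show "quad_sols c d k \<subseteq> ?I \<times> ?I \<times> ?I \<times> ?I"
  proof
    fix p
    assume "p \<in> quad_sols c d k"
    then obtain x y z w where p: "p = (x, y, z, w)"
      and k: "k = c * (x\<^sup>2 + y\<^sup>2 + z\<^sup>2) + d * w\<^sup>2"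
      by (auto simp: quad_sols_def)
    have "1 * (x\<^sup>2 + y\<^sup>2 + z\<^sup>2) \<le> c * (x\<^sup>2 + y\<^sup>2 + z\<^sup>2)" "1 * w\<^sup>2 \<le> d * w\<^sup>2"
      using assms by (intro mult_right_mono; simp)+
    then have "x\<^sup>2 + y\<^sup>2 + z\<^sup>2 + w\<^sup>2 \<le> k"
      unfolding k mult_1_left by (rule add_mono)
    then show "p \<in> ?I \<times> ?I \<times> ?I \<times> ?I"
      using le[of x] le[of y] le[of z] le[of w] unfolding p by auto
  qed
qed simp

lemma bij_betw_of_inverse:
  assumes "\<And>p. p \<in> A \<Longrightarrow> f p \<in> B \<and> g (f p) = p" "\<And>p. p \<in> B \<Longrightarrow> g p \<in> A \<and> f (g p) = p"
  shows "bij_betw f A B"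
  using assms by (intro bij_betw_byWitness[where f' = g]) auto

section \<open>The correspondence between solutions for \<open>m\<close> and for
  \<open>2 * m\<close>\<close>

text \<open>Since \<open>c * d = 7\<close>, replacing \<open>(z, w)\<close> by
  \<open>z' = (z - d * w) / 2\<close> and \<open>w' = (c * z + w) / 2\<close> doubles
  \<open>c * z\<^sup>2 + d * w\<^sup>2\<close>. Moreover \<open>z' + d * w' = 4 * z\<close> and
  \<open>w' - c * z' = 4 * w\<close>, which gives both the divisibility condition and the
  inverse.\<close>

lemma card_even_tail_eq:
  fixes c d m :: int
  assumes cd: "c = 1 \<and> d = 7 \<or> c = 7 \<and> d = 1" and m: "4 dvd m - c"
  shows "card {(x, y, z, w) \<in> quad_sols c d m. even (z - w)}
    = card {(x, y, z, w) \<in> quad_sols c d (2 * m). odd x \<and> odd y \<and> 4 dvd z + d * w}"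
    (is "card ?S = card ?T")
proof (rule bij_betw_same_card)
  \<comment> \<open>multiplication by \<open>1 + i\<close> and by \<open>\<pi>\<close> (up to units and conjugation), and its inverse\<close>
  let ?f = "\<lambda>(x, y, z, w). (x + y, x - y, (z - d * w) div 2, (c * z + w) div 2)"
  let ?g = "\<lambda>(x, y, z, w). ((x + y) div 2, (x - y) div 2, (z + d * w) div 4, (w - c * z) div 4)"
  have f: "?f (x, y, z, w) \<in> ?T \<and> ?g (?f (x, y, z, w)) = (x, y, z, w)"
    if sol: "(x, y, z, w) \<in> quad_sols c d m" and zw: "even (z - w)" for x y z w
  proof -
    from zw obtain k where "z - w = 2 * k" by blast
    then have k: "z = w + 2 * k" by simp
    \<comment> \<open>As \<open>z\<close> and \<open>w\<close> agree in parity, the one coordinate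
      that differs from \<open>w\<close> is \<open>x\<close> or \<open>y\<close>.\<close>
    have odd: "odd (x - y)" "odd (x + y)"
      using quad_sols_parity[OF cd m sol] zw by auto
    from cd show ?thesis
    proof (elim disjE conjE)
      assume cd: "c = 1" "d = 7"
      have half: "(z - 7 * w) div 2 = k - 3 * w" "(z + w) div 2 = w + k"
        using k by simp_all
      have "m = x\<^sup>2 + y\<^sup>2 + (w + 2 * k)\<^sup>2 + 7 * w\<^sup>2"
        using sol by (simp add: quad_sols_def cd k)
      then have "(x + y)\<^sup>2 + (x - y)\<^sup>2 + (k - 3 * w)\<^sup>2 + 7 * (w + k)\<^sup>2 = 2 * m"
        by (simp add: power2_eq_square algebra_simps)
      moreover have "4 dvd (k - 3 * w) + 7 * (w + k)" by presburger
      ultimately show ?thesis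
        using odd by (simp add: cd half quad_sols_def k)
    next
      assume cd: "c = 7" "d = 1"
      have half: "(z - w) div 2 = k" "(7 * z + w) div 2 = 4 * w + 7 * k"
        using k by simp_all
      have "m = 7 * (x\<^sup>2 + y\<^sup>2 + (w + 2 * k)\<^sup>2) + w\<^sup>2"
        using sol by (simp add: quad_sols_def cd k)
      then have "7 * ((x + y)\<^sup>2 + (x - y)\<^sup>2 + k\<^sup>2) + (4 * w + 7 * k)\<^sup>2 = 2 * m"
        by (simp add: power2_eq_square algebra_simps)
      moreover have "4 dvd k + (4 * w + 7 * k)" by presburger
      ultimately show ?thesis
        using odd by (simp add: cd half quad_sols_def k)
    qed
  qed
  have g: "?g (x, y, z, w) \<in> ?S \<and> ?f (?g (x, y, z, w)) = (x, y, z, w)"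
    if sol: "(x, y, z, w) \<in> quad_sols c d (2 * m)" and xy: "odd x" "odd y"
      and zw: "4 dvd z + d * w" for x y z w
  proof -
    from xy have "even (x - y)" by simp
    then obtain v where "x - y = 2 * v" by blast
    then have v: "x = y + 2 * v" by simp
    from zw obtain k where "z + d * w = 4 * k" by blast
    then have k: "z = 4 * k - d * w" by simp
    have half: "(x + y) div 2 = y + v" "(x - y) div 2 = v" "(z + d * w) div 4 = k"
      using v k by simp_all
    from cd show ?thesis
    proof (elim disjE conjE)
      assume cd: "c = 1" "d = 7"
      \<comment> \<open>In both cases \<open>w - c * z = 8 * w - 4 * c * k\<close>, so the last
        quotient is integral as well.\<close>
      have quarter: "(w - z) div 4 = 2 * w - k"
        using k cd by simp
      have "2 * m = (y + 2 * v)\<^sup>2 + y\<^sup>2 + (4 * k - 7 * w)\<^sup>2 + 7 * w\<^sup>2"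
        using sol by (simp add: quad_sols_def cd k v)
      then have "(y + v)\<^sup>2 + v\<^sup>2 + k\<^sup>2 + 7 * (2 * w - k)\<^sup>2 = m"
        by (simp add: power2_eq_square algebra_simps)
      then show ?thesis
        using half quarter by (simp add: cd quad_sols_def k v)
    next
      assume cd: "c = 7" "d = 1"
      have quarter: "(w - 7 * z) div 4 = 2 * w - 7 * k"
        using k cd by simp
      have "2 * m = 7 * ((y + 2 * v)\<^sup>2 + y\<^sup>2 + (4 * k - w)\<^sup>2) + w\<^sup>2"
        using sol by (simp add: quad_sols_def cd k v)
      then have "7 * ((y + v)\<^sup>2 + v\<^sup>2 + k\<^sup>2) + (2 * w - 7 * k)\<^sup>2 = m"
        by (simp add: power2_eq_square algebra_simps)
      then show ?thesis
        using half quarter by (simp add: cd quad_sols_def k v)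
    qed
  qed
  have "?f p \<in> ?T \<and> ?g (?f p) = p" if "p \<in> ?S" for p
  proof -
    obtain x y z w where p: "p = (x, y, z, w)" by (cases p)
    show ?thesis using that unfolding p by (intro f) auto
  qed
  moreover have "?g p \<in> ?S \<and> ?f (?g p) = p" if "p \<in> ?T" for p
  proof -
    obtain x y z w where p: "p = (x, y, z, w)" by (cases p)
    show ?thesis using that unfolding p by (intro g) auto
  qed
  ultimately show "bij_betw ?f ?S ?T"
    by (rule bij_betw_of_inverse)
qed

text \<open>Inclusion-exclusion for the images \<open>?P\<close> and \<open>?M\<close> of the two
  injections, whose union is \<open>?O \<union> ?E\<close> and whose intersection is
  \<open>?E\<close>.\<close>

lemma odd_sols_recurrence:
  fixes c d m :: int
  assumes cd: "c = 1 \<and> d = 7 \<or> c = 7 \<and> d = 1" and m: "4 dvd m - c"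
  shows "card {(x, y, z, w) \<in> quad_sols c d (2 * m). odd x \<and> odd y \<and> odd z \<and> odd w}
      + 2 * card {(x, y, z, w) \<in> quad_sols c d (2 * m). odd x \<and> odd y \<and> even z \<and> even w}
    = 2 * card {(x, y, z, w) \<in> quad_sols c d m. even (z - w)}"
    (is "card ?O + 2 * card ?E = 2 * card ?S")
proof -
  let ?P = "{(x, y, z, w) \<in> quad_sols c d (2 * m). odd x \<and> odd y \<and> 4 dvd z + d * w}"
  let ?M = "{(x, y, z, w) \<in> quad_sols c d (2 * m). odd x \<and> odd y \<and> 4 dvd z - d * w}"
  have fin: "finite (quad_sols c d (2 * m))"
    using cd by (intro finite_quad_sols) auto
  have finite: "finite ?P" "finite ?M" "finite ?O" "finite ?E"
    by (rule finite_subset[OF _ fin]; fast)+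
  \<comment> \<open>Changing the sign of \<open>w\<close> is the conjugation that exchanges \<pi>
    and its conjugate.\<close>
  have "bij_betw (\<lambda>(x, y, z, w). (x, y, z, - w)) ?P ?M"
    by (rule bij_betw_byWitness[where f' = "\<lambda>(x, y, z, w). (x, y, z, - w)"])
      (auto simp: quad_sols_def)
  then have PM: "card ?M = card ?P"
    by (simp add: bij_betw_same_card)
  \<comment> \<open>Both numbers are even and their sum \<open>2 * z\<close> is 2 modulo 4, so
    exactly one is divisible by 4.\<close>
  have odd_cases: "4 dvd z + d * w \<or> 4 dvd z - d * w" "\<not> (4 dvd z + d * w \<and> 4 dvd z - d * w)"
    if "odd z" "odd w" for z w
    using cd that by (elim disjE conjE; hypsubst; presburger)+
  have even_tail: "even z \<longleftrightarrow> even w"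
    if "(x, y, z, w) \<in> quad_sols c d (2 * m)" "odd x" "odd y" for x y z w
    using quad_sols_parity_twice[OF cd m that(1)] that(2,3) by blast
  have pointwise: "(p \<in> ?P \<union> ?M \<longleftrightarrow> p \<in> ?O \<union> ?E) \<and> (p \<in> ?P \<inter> ?M \<longleftrightarrow> p \<in> ?E)" for p
  proof -
    obtain x y z w where p: "p = (x, y, z, w)" by (cases p)
    show ?thesis
      unfolding p
      using odd_cases[of z w] even_tail[of x y z w] four_dvd_of_even_tail[OF cd m, of x y z w]
      by (cases "even z") auto
  qed
  have un: "?P \<union> ?M = ?O \<union> ?E"
    by (rule set_eqI) (rule conjunct1[OF pointwise])
  have int: "?P \<inter> ?M = ?E"
    by (rule set_eqI) (rule conjunct2[OF pointwise])
  have "card ?P + card ?M = card (?O \<union> ?E) + card ?E"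
    using card_Un_Int[OF finite(1,2)] un int by simp
  also have "card (?O \<union> ?E) = card ?O + card ?E"
    by (rule card_Un_disjoint[OF finite(3,4)]) fast
  finally show ?thesis
    using card_even_tail_eq[OF cd m] PM by simp
qed

section \<open>Counting by parity classes\<close>

lemma card_quad_sols_twice:
  fixes c d m :: int
  assumes cd: "c = 1 \<and> d = 7 \<or> c = 7 \<and> d = 1" and m: "4 dvd m - c"
  shows "card (quad_sols c d (2 * m))
    = card {(x, y, z, w) \<in> quad_sols c d (2 * m). odd x \<and> odd y \<and> odd z \<and> odd w}
      + 3 * card {(x, y, z, w) \<in> quad_sols c d (2 * m). odd x \<and> odd y \<and> even z \<and> even w}"
    (is "card ?X = card ?O + 3 * card ?E")
proof -
  let ?E2 = "{(x, y, z, w) \<in> ?X. odd x \<and> even y \<and> odd z \<and> even w}"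
  let ?E3 = "{(x, y, z, w) \<in> ?X. even x \<and> odd y \<and> odd z \<and> even w}"
  have fin: "finite ?X"
    using cd by (intro finite_quad_sols) auto
  have finite: "finite ?O" "finite ?E" "finite ?E2" "finite ?E3"
    by (rule finite_subset[OF _ fin]; fast)+
  have "bij_betw (\<lambda>(x, y, z, w). (x, z, y, w)) ?E ?E2"
    by (rule bij_betw_byWitness[where f' = "\<lambda>(x, y, z, w). (x, z, y, w)"])
      (auto simp: quad_sols_def algebra_simps)
  then have E2: "card ?E2 = card ?E"
    by (simp add: bij_betw_same_card)
  have "bij_betw (\<lambda>(x, y, z, w). (z, y, x, w)) ?E ?E3"
    by (rule bij_betw_byWitness[where f' = "\<lambda>(x, y, z, w). (z, y, x, w)"])
      (auto simp: quad_sols_def algebra_simps)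
  then have E3: "card ?E3 = card ?E"
    by (simp add: bij_betw_same_card)
  have X: "?X = ?O \<union> (?E \<union> (?E2 \<union> ?E3))"
    using quad_sols_parity_twice[OF cd m] by auto
  have "card (?O \<union> (?E \<union> (?E2 \<union> ?E3))) = card ?O + card (?E \<union> (?E2 \<union> ?E3))"
    by (rule card_Un_disjoint) (use finite in \<open>blast, blast, fast\<close>)
  also have "card (?E \<union> (?E2 \<union> ?E3)) = card ?E + card (?E2 \<union> ?E3)"
    by (rule card_Un_disjoint) (use finite in \<open>blast, blast, fast\<close>)
  also have "card (?E2 \<union> ?E3) = card ?E2 + card ?E3"
    by (rule card_Un_disjoint) (use finite in \<open>blast, blast, fast\<close>)
  finally show ?thesis
    using E2 E3 X by simp
qed

text \<open>The solutions split by the coordinate that differs from \<open>w\<close> in parity into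
  \<open>?D1\<close>, \<open>?D2\<close>, \<open>?D3\<close>, which transpositions make equal in
  size; \<open>?S\<close> is the union of the first two.\<close>

lemma card_quad_sols_eq:
  fixes c d m :: int
  assumes cd: "c = 1 \<and> d = 7 \<or> c = 7 \<and> d = 1" and m: "4 dvd m - c"
  shows "2 * card (quad_sols c d m) = 3 * card {(x, y, z, w) \<in> quad_sols c d m. even (z - w)}"
    (is "2 * card ?X = 3 * card ?S")
proof -
  let ?D1 = "{(x, y, z, w) \<in> ?X. odd (x - w)}"
  let ?D2 = "{(x, y, z, w) \<in> ?X. odd (y - w)}"
  let ?D3 = "{(x, y, z, w) \<in> ?X. odd (z - w)}"
  have fin: "finite ?X"
    using cd by (intro finite_quad_sols) auto
  have finite: "finite ?D1" "finite ?D2" "finite ?D3" "finite ?S"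
    by (rule finite_subset[OF _ fin]; fast)+
  have "bij_betw (\<lambda>(x, y, z, w). (z, y, x, w)) ?D3 ?D1"
    by (rule bij_betw_byWitness[where f' = "\<lambda>(x, y, z, w). (z, y, x, w)"])
      (auto simp: quad_sols_def algebra_simps)
  then have D1: "card ?D1 = card ?D3"
    by (simp add: bij_betw_same_card)
  have "bij_betw (\<lambda>(x, y, z, w). (x, z, y, w)) ?D3 ?D2"
    by (rule bij_betw_byWitness[where f' = "\<lambda>(x, y, z, w). (x, z, y, w)"])
      (auto simp: quad_sols_def algebra_simps)
  then have D2: "card ?D2 = card ?D3"
    by (simp add: bij_betw_same_card)
  have S: "?S = ?D1 \<union> ?D2"
    using quad_sols_parity[OF cd m] by fast
  have "card (?D1 \<union> ?D2) = card ?D1 + card ?D2"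
    by (rule card_Un_disjoint[OF finite(1,2)]) (use quad_sols_parity[OF cd m] in fast)
  with D1 D2 have card_S: "card ?S = 2 * card ?D3"
    unfolding S by linarith
  have X: "?S \<union> ?D3 = ?X" by fast
  have "card (?S \<union> ?D3) = card ?S + card ?D3"
    by (rule card_Un_disjoint[OF finite(4,3)]) fast
  with card_S show ?thesis
    unfolding X by linarith
qed

text \<open>Eliminate \<open>S\<close> and \<open>E\<close>:
  \<open>4 N(m) = 6 S = 3 O + 6 E\<close>, while \<open>2 N(2m) = 2 O + 6 E\<close>.\<close>

lemma card_odd_quad_sols:
  fixes c d m :: int
  assumes cd: "c = 1 \<and> d = 7 \<or> c = 7 \<and> d = 1" and m: "4 dvd m - c"
  shows "int (card {(x, y, z, w) \<in> quad_sols c d (2 * m). odd x \<and> odd y \<and> odd z \<and> odd w})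
    = 4 * int (card (quad_sols c d m)) - 2 * int (card (quad_sols c d (2 * m)))"
  using odd_sols_recurrence[OF cd m] card_quad_sols_twice[OF cd m] card_quad_sols_eq[OF cd m]
  by linarith

section \<open>From lists to quadruples\<close>

lemma length_eq_4E:
  assumes "length xs = 4"
  obtains x y z w where "xs = [x, y, z, w]"
  using assms by (auto simp: numeral_eq_Suc length_Suc_conv)

lemma triangular_eq:
  fixes x :: int
  shows "8 * (x * (x - 1) div 2) = (2 * x - 1)\<^sup>2 - 1"
proof -
  have "even (x * (x - 1))" by simp
  then have "2 * (x * (x - 1) div 2) = x * (x - 1)" by (rule dvd_mult_div_cancel)
  then have "8 * (x * (x - 1) div 2) = 4 * (x * (x - 1))" by linarith
  also have "\<dots> = (2 * x - 1)\<^sup>2 - 1" by (simp add: power2_eq_square algebra_simps)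
  finally show ?thesis .
qed

lemma N_rep_1117: "N_rep [1,1,1,7] k = card (quad_sols 1 7 (int k))"
  unfolding N_rep_def
proof (intro bij_betw_same_card bij_betw_of_inverse)
  let ?f = "\<lambda>xs :: int list. (xs ! 0, xs ! 1, xs ! 2, xs ! 3)"
  let ?g = "\<lambda>(x, y, z, w). [x, y, z, w]"
  show "?f p \<in> quad_sols 1 7 (int k) \<and> ?g (?f p) = p" if "p \<in> rep_squares [1,1,1,7] k" for p
  proof -
    have "length p = 4" using that by (simp add: rep_squares_def)
    then obtain x y z w where "p = [x, y, z, w]" by (rule length_eq_4E)
    with that show ?thesis
      by (simp add: rep_squares_def quad_sols_def lessThan_Suc numeral_eq_Suc)
  qed
  show "?g p \<in> rep_squares [1,1,1,7] k \<and> ?f (?g p) = p" if "p \<in> quad_sols 1 7 (int k)" for p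
    using that
    by (cases p) (simp add: rep_squares_def quad_sols_def lessThan_Suc numeral_eq_Suc)
qed

lemma N_rep_1777: "N_rep [1,7,7,7] k = card (quad_sols 7 1 (int k))"
  unfolding N_rep_def
proof (intro bij_betw_same_card bij_betw_of_inverse)
  \<comment> \<open>The list has the lone coefficient 1 first, while \<open>quad_sols\<close> has it
    last; hence the rotation.\<close>
  let ?f = "\<lambda>xs :: int list. (xs ! 1, xs ! 2, xs ! 3, xs ! 0)"
  let ?g = "\<lambda>(x, y, z, w). [w, x, y, z]"
  show "?f p \<in> quad_sols 7 1 (int k) \<and> ?g (?f p) = p" if "p \<in> rep_squares [1,7,7,7] k" for p
  proof -
    have "length p = 4" using that by (simp add: rep_squares_def)
    then obtain x y z w where "p = [x, y, z, w]" by (rule length_eq_4E)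
    with that show ?thesis
      by (simp add: rep_squares_def quad_sols_def lessThan_Suc numeral_eq_Suc)
  qed
  show "?g p \<in> rep_squares [1,7,7,7] k \<and> ?f (?g p) = p" if "p \<in> quad_sols 7 1 (int k)" for p
    using that
    by (cases p) (simp add: rep_squares_def quad_sols_def lessThan_Suc numeral_eq_Suc)
qed

lemma t_rep_1117:
  "t_rep [1,1,1,7] n
    = card {(x, y, z, w) \<in> quad_sols 1 7 (8 * int n + 10). odd x \<and> odd y \<and> odd z \<and> odd w}"
  (is "_ = card ?O")
  unfolding t_rep_def
proof (intro bij_betw_same_card bij_betw_of_inverse)
  let ?f = "\<lambda>xs :: int list. (2 * xs ! 0 - 1, 2 * xs ! 1 - 1, 2 * xs ! 2 - 1, 2 * xs ! 3 - 1)"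
  let ?g = "\<lambda>(x, y, z, w). [(x + 1) div 2, (y + 1) div 2, (z + 1) div 2, (w + 1) div 2]"
  \<comment> \<open>Multiply by 8 and complete squares; the constant 10 is
    \<open>1 + 1 + 1 + 7\<close>.\<close>
  have mem: "[x, y, z, w] \<in> rep_triangular [1,1,1,7] n
      \<longleftrightarrow> (2 * x - 1, 2 * y - 1, 2 * z - 1, 2 * w - 1) \<in> quad_sols 1 7 (8 * int n + 10)" for x y z w
    using triangular_eq[of x] triangular_eq[of y] triangular_eq[of z] triangular_eq[of w]
    by (simp add: rep_triangular_def quad_sols_def lessThan_nat_numeral) linarith
  show "?f p \<in> ?O \<and> ?g (?f p) = p" if "p \<in> rep_triangular [1,1,1,7] n" for p
  proof -
    have "length p = 4" using that by (simp add: rep_triangular_def)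
    then obtain x y z w where p: "p = [x, y, z, w]" by (rule length_eq_4E)
    from that show ?thesis
      unfolding p mem by (simp add: numeral_eq_Suc)
  qed
  show "?g p \<in> rep_triangular [1,1,1,7] n \<and> ?f (?g p) = p" if "p \<in> ?O" for p
  proof -
    obtain x y z w where p: "p = (x, y, z, w)" by (cases p)
    \<comment> \<open>For odd \<open>v\<close> the left side equals
      \<open>2 * ((v + 1) div 2) - 1\<close>, so \<open>?f\<close> undoes \<open>?g\<close>.\<close>
    have half: "1 + 2 * (v div 2) = v" if "odd v" for v :: int
      using that by presburger
    from that have "odd x" "odd y" "odd z" "odd w" "(x, y, z, w) \<in> quad_sols 1 7 (8 * int n + 10)"
      by (simp_all add: p)
    then show ?thesis
      by (simp add: p mem half del: One_nat_def)
  qed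
qed

lemma t_rep_1777:
  "t_rep [1,7,7,7] n
    = card {(x, y, z, w) \<in> quad_sols 7 1 (8 * int n + 22). odd x \<and> odd y \<and> odd z \<and> odd w}"
  (is "_ = card ?O")
  unfolding t_rep_def
proof (intro bij_betw_same_card bij_betw_of_inverse)
  let ?f = "\<lambda>xs :: int list. (2 * xs ! 1 - 1, 2 * xs ! 2 - 1, 2 * xs ! 3 - 1, 2 * xs ! 0 - 1)"
  let ?g = "\<lambda>(x, y, z, w). [(w + 1) div 2, (x + 1) div 2, (y + 1) div 2, (z + 1) div 2]"
  \<comment> \<open>The constant 22 is \<open>1 + 7 + 7 + 7\<close>.\<close>
  have mem: "[w, x, y, z] \<in> rep_triangular [1,7,7,7] n
      \<longleftrightarrow> (2 * x - 1, 2 * y - 1, 2 * z - 1, 2 * w - 1) \<in> quad_sols 7 1 (8 * int n + 22)" for x y z w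
    using triangular_eq[of x] triangular_eq[of y] triangular_eq[of z] triangular_eq[of w]
    by (simp add: rep_triangular_def quad_sols_def lessThan_nat_numeral) linarith
  show "?f p \<in> ?O \<and> ?g (?f p) = p" if "p \<in> rep_triangular [1,7,7,7] n" for p
  proof -
    have "length p = 4" using that by (simp add: rep_triangular_def)
    then obtain w x y z where p: "p = [w, x, y, z]" by (rule length_eq_4E)
    from that show ?thesis
      unfolding p mem by (simp add: numeral_eq_Suc)
  qed
  show "?g p \<in> rep_triangular [1,7,7,7] n \<and> ?f (?g p) = p" if "p \<in> ?O" for p
  proof -
    obtain x y z w where p: "p = (x, y, z, w)" by (cases p)
    have half: "1 + 2 * (v div 2) = v" if "odd v" for v :: int
      using that by presburger
    from that have "odd x" "odd y" "odd z" "odd w" "(x, y, z, w) \<in> quad_sols 7 1 (8 * int n + 22)"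
      by (simp_all add: p)
    then show ?thesis
      by (simp add: p mem half del: One_nat_def)
  qed
qed

theorem theorem5p16:
  fixes n :: nat
  assumes "n > 0"
  shows "int (t_rep [1,1,1,7] n)
           = 4 * int (N_rep [1,1,1,7] (4*n + 5)) - 2 * int (N_rep [1,1,1,7] (8*n + 10))
       \<and> int (t_rep [1,7,7,7] n)
           = 4 * int (N_rep [1,7,7,7] (4*n + 11)) - 2 * int (N_rep [1,7,7,7] (8*n + 22))"
proof
  \<comment> \<open>Here \<open>m = 4 * n + 5\<close> is 1 modulo 4; below,
    \<open>m = 4 * n + 11\<close> is 7 modulo 4.\<close>
  have "2 * (4 * int n + 5) = 8 * int n + 10" "4 dvd (4 * int n + 5) - 1" by presburger+
  then show "int (t_rep [1,1,1,7] n)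
      = 4 * int (N_rep [1,1,1,7] (4*n + 5)) - 2 * int (N_rep [1,1,1,7] (8*n + 10))"
    using card_odd_quad_sols[of 1 7 "4 * int n + 5"]
    by (simp add: t_rep_1117 N_rep_1117 del: One_nat_def)
  have "2 * (4 * int n + 11) = 8 * int n + 22" "4 dvd (4 * int n + 11) - 7" by presburger+
  then show "int (t_rep [1,7,7,7] n)
      = 4 * int (N_rep [1,7,7,7] (4*n + 11)) - 2 * int (N_rep [1,7,7,7] (8*n + 22))"
    using card_odd_quad_sols[of 7 1 "4 * int n + 11"]
    by (simp add: t_rep_1777 N_rep_1777 del: One_nat_def)
qed

end
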